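(* Let $x \in \mathscr{A}^{\mathbb{Z}}$ be a non-periodic Toeplitz word and let $\Omega$ denote the associated odometer. Assume $\omega \in B_X$ and $a \in \mathscr{A}$ are such that $(\omega,a) \in F_x$ is an isolated point of $\bigcup_{\widetilde{\omega} \in B_X} F_x(\widetilde{\omega})$. Then there exists a factor subshift $X_{\Psi(x)} = \Psi(X_x)$ of $X_x$ with the same associated odometer $\Omega$ and with $B_{\Psi(X)} = \{\omega\}$.
   Context: $\mathscr{A}$ is a finite alphabet; $\mathscr{A}^{\mathbb{Z}}$ carries the product topology and the left shift $\sigma(x)(j) = x(j+1)$. A word $x \in \mathscr{A}^{\mathbb{Z}}$ is a Toeplitz word if for every $j \in \mathbb{Z}$ there is $p \in \mathbb{N}$ with $x(j) = x(j+np)$ for all $n \in \mathbb{N}$ (equivalently, all $n\in\mathbb{Z}$). $X_x$ denotes the closure of $\{\sigma^n(x) : n \in \mathbb{Z}\}$ (a Toeplitz subshift). Put $\mathrm{Per}(p,x,a) = \{j \in \mathbb{Z} : x(j+np) = a \text{ for all } n \in \mathbb{Z}\}$ and $\mathrm{Per}(p,x) = \bigcup_{a \in \mathscr{A}} \mathrm{Per}(p,x,a)$. A period structure of $x$ is a sequence $(p_l)_{l \in \mathbb{N}}$ of positive integers with (i) $p_l \mid p_{l+1}$; (ii) $\emptyset \neq \mathrm{Per}(p_l,x) \neq \mathrm{Per}(p,x)$ for all $0<p<p_l$; (iii) $\bigcup_l \mathrm{Per}(p_l,x) = \mathbb{Z}$. Every Toeplitz word has one. The odometer associated to $x$ is $\Omega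 = \varprojlim \mathbb{Z}/p_l\mathbb{Z}$ (inverse limit topology) with rotation $\varrho(\omega) = \omega + (1,1,1,\dots)$; up to isomorphism it does not depend on the period structure, and it is the maximal equicontinuous factor of $X_x$. Let $\eta : \mathbb{Z} \to \Omega$, $\eta(j) = (j \bmod p_1, j \bmod p_2, \dots)$. The semicocycle of $x$ is the (continuous) map $\tau_x : \eta(\mathbb{Z}) \to \mathscr{A}$, $\eta(j) \mapsto x(j)$. $F_x \subseteq \Omega \times \mathscr{A}$ is the closure of the graph of $\tau_x$, and $F_x(\omega) = \{(\omega,a) \in F_x : a \in \mathscr{A}\}$. $B_X \subseteq \Omega$ is the set of discontinuities of $\tau_x$, i.e. the set of all $\omega \in \Omega$ for which $F_x(\omega)$ is not a singleton. A factor map between subshifts is a continuous surjective shift-commuting map; it is given by a sliding block code $\psi : \mathscr{A}^{[-J,J]} \to \mathscr{A}$ via $\Psi(x)(j) = \psi(x[j-J,j+J])$. A factor $\Psi(X_x)$ of a Toeplitz subshift is the Toeplitz subshift $X_{\Psi(x)}$. "The same associated odometer" means that the odometer associated to $\Psi(x)$ is isomorphic to $\Omega$, identified with it via $\eta$ (the image of $j$ in one odometer corresponds to the image of $j$ in the other). $B_{\Psi(X)} \subseteq \Omega$ is the set of discontinuities of $\tau_{\Psi(x)} : \eta(j) \mapsto \Psi(x)(j)$, defined in the same way. *)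

theory Defs
  imports "HOL-Analysis.Analysis"
begin

subsection \<open>Words and subshifts\<close>

text \<open>The finite alphabet is a type of class \<open>finite\<close>, regarded as discrete; a bi-infinite word is
  a function on the integers.\<close>

abbreviation word_top :: "(int \<Rightarrow> 'a) topology" where
  "word_top \<equiv> product_topology (\<lambda>_. discrete_topology UNIV) UNIV"

definition shift_by :: "int \<Rightarrow> (int \<Rightarrow> 'a) \<Rightarrow> int \<Rightarrow> 'a" where
  "shift_by n x = (\<lambda>j. x (j + n))"

abbreviation shift :: "(int \<Rightarrow> 'a) \<Rightarrow> int \<Rightarrow> 'a" where
  "shift \<equiv> shift_by 1"

definition toeplitz_word :: "(int \<Rightarrow> 'a) \<Rightarrow> bool" where
  "toeplitz_word x \<longleftrightarrow> (\<forall>j. \<exists>p::nat. p > 0 \<and> (\<forall>n::nat. x j = x (j + int n * int p)))"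

definition periodic_word :: "(int \<Rightarrow> 'a) \<Rightarrow> bool" where
  "periodic_word x \<longleftrightarrow> (\<exists>p::nat. p > 0 \<and> (\<forall>j. x (j + int p) = x j))"

definition orbit_closure :: "(int \<Rightarrow> 'a) \<Rightarrow> (int \<Rightarrow> 'a) set" where
  "orbit_closure x = word_top closure_of range (\<lambda>n. shift_by n x)"

text \<open>Only the values of the map on \<open>X\<close> matter.\<close>

definition factor_map ::
    "((int \<Rightarrow> 'a) \<Rightarrow> int \<Rightarrow> 'a) \<Rightarrow> (int \<Rightarrow> 'a) set \<Rightarrow> (int \<Rightarrow> 'a) set \<Rightarrow> bool" where
  "factor_map \<Psi> X Y \<longleftrightarrow>
     continuous_map (subtopology word_top X) (subtopology word_top Y) \<Psi> \<and>
     \<Psi> ` X = Y \<and> (\<forall>z\<in>X. \<Psi> (shift z) = shift (\<Psi> z))"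


subsection \<open>Period structures and odometers\<close>

definition Per_letter :: "nat \<Rightarrow> (int \<Rightarrow> 'a) \<Rightarrow> 'a \<Rightarrow> int set" where
  "Per_letter p x a = {j. \<forall>n::int. x (j + n * int p) = a}"

definition Per :: "nat \<Rightarrow> (int \<Rightarrow> 'a) \<Rightarrow> int set" where
  "Per p x = (\<Union>a. Per_letter p x a)"

definition period_structure :: "(nat \<Rightarrow> nat) \<Rightarrow> (int \<Rightarrow> 'a) \<Rightarrow> bool" where
  "period_structure p x \<longleftrightarrow>
     (\<forall>l. p l > 0) \<and>
     (\<forall>l. p l dvd p (Suc l)) \<and>
     (\<forall>l. Per (p l) x \<noteq> {} \<and> (\<forall>q. 0 < q \<and> q < p l \<longrightarrow> Per (p l) x \<noteq> Per q x)) \<and>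
     (\<Union>l. Per (p l) x) = UNIV"

text \<open>The inverse limit of the cyclic groups of order \<open>p l\<close>, each represented by its residues
  \<open>0, \<dots>, p l - 1\<close> with the discrete topology.\<close>

definition odometer :: "(nat \<Rightarrow> nat) \<Rightarrow> (nat \<Rightarrow> int) set" where
  "odometer p = {\<omega>. \<forall>l. \<omega> l \<in> {0..<int (p l)} \<and> \<omega> (Suc l) mod int (p l) = \<omega> l}"

definition odometer_top :: "(nat \<Rightarrow> nat) \<Rightarrow> (nat \<Rightarrow> int) topology" where
  "odometer_top p =
     subtopology (product_topology (\<lambda>l. discrete_topology {0..<int (p l)}) UNIV) (odometer p)"

definition rotation :: "(nat \<Rightarrow> nat) \<Rightarrow> (nat \<Rightarrow> int) \<Rightarrow> nat \<Rightarrow> int" where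
  "rotation p \<omega> = (\<lambda>l. (\<omega> l + 1) mod int (p l))"

definition eta :: "(nat \<Rightarrow> nat) \<Rightarrow> int \<Rightarrow> nat \<Rightarrow> int" where
  "eta p j = (\<lambda>l. j mod int (p l))"

text \<open>The odometer associated to \<open>y\<close> is the odometer of \<open>p\<close>, the two being identified through
  the images of the integers. Since the odometer of \<open>y\<close> is independent of its period structure up
  to isomorphism, any period structure of \<open>y\<close> may serve as witness.\<close>

definition has_odometer :: "(int \<Rightarrow> 'a) \<Rightarrow> (nat \<Rightarrow> nat) \<Rightarrow> bool" where
  "has_odometer y p \<longleftrightarrow>
     (\<exists>q h. period_structure q y \<and>
        homeomorphic_map (odometer_top q) (odometer_top p) h \<and>
        (\<forall>\<omega>\<in>odometer q. h (rotation q \<omega>) = rotation p (h \<omega>)) \<and>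
        (\<forall>j. h (eta q j) = eta p j))"


subsection \<open>The semicocycle and its discontinuities\<close>

text \<open>In the following definitions \<open>p\<close> only determines the odometer: it need not be a period
  structure of \<open>x\<close>, so that they also apply to a factor of a word with period structure \<open>p\<close>.\<close>

abbreviation odometer_letter_top :: "(nat \<Rightarrow> nat) \<Rightarrow> ((nat \<Rightarrow> int) \<times> 'a) topology" where
  "odometer_letter_top p \<equiv> prod_topology (odometer_top p) (discrete_topology UNIV)"

definition semicocycle_graph :: "(nat \<Rightarrow> nat) \<Rightarrow> (int \<Rightarrow> 'a) \<Rightarrow> ((nat \<Rightarrow> int) \<times> 'a) set" where
  "semicocycle_graph p x = range (\<lambda>j. (eta p j, x j))"

definition graph_closure :: "(nat \<Rightarrow> nat) \<Rightarrow> (int \<Rightarrow> 'a) \<Rightarrow> ((nat \<Rightarrow> int) \<times> 'a) set" where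
  "graph_closure p x = odometer_letter_top p closure_of semicocycle_graph p x"

definition graph_fibre ::
    "(nat \<Rightarrow> nat) \<Rightarrow> (int \<Rightarrow> 'a) \<Rightarrow> (nat \<Rightarrow> int) \<Rightarrow> ((nat \<Rightarrow> int) \<times> 'a) set" where
  "graph_fibre p x \<omega> = {(\<omega>, a) | a. (\<omega>, a) \<in> graph_closure p x}"

definition discontinuities :: "(nat \<Rightarrow> nat) \<Rightarrow> (int \<Rightarrow> 'a) \<Rightarrow> (nat \<Rightarrow> int) set" where
  "discontinuities p x = {\<omega> \<in> odometer p. \<not> is_singleton (graph_fibre p x \<omega>)}"

definition isolated_point_of :: "'b topology \<Rightarrow> 'b \<Rightarrow> 'b set \<Rightarrow> bool" where
  "isolated_point_of T z S \<longleftrightarrow> z \<in> S \<and> z \<notin> T derived_set_of S"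

end

theory Submission
  imports Defs
begin

text \<open>By isolation there is a cylinder \<open>U\<close> around \<open>\<omega>\<close>, given by a residue modulo some \<open>p L\<close>, in which
  \<open>\<omega>\<close> is the only discontinuity whose fibre contains the letter \<open>a\<close>. Keep the occurrences of \<open>a\<close> at
  positions in \<open>U\<close> and overwrite all other positions by a second letter \<open>b\<close>. This is a block code,
  because a long block of \<open>x\<close> determines its position modulo \<open>p L\<close>, and the only point at which
  the new semicocycle has both limit values is \<open>\<omega>\<close>. The odometer cannot shrink, since the set of
  discontinuities is invariant under the kernel of the projection to the odometer of the factor.\<close>

section \<open>Periodic parts\<close>

lemma Per_iff: "j \<in> Per p x \<longleftrightarrow> (\<forall>n::int. x (j + n * int p) = x j)"
proof
  assume "j \<in> Per p x"
  then obtain c where c: "\<And>n::int. x (j + n * int p) = c"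
    by (auto simp: Per_def Per_letter_def)
  from c[of 0] c show "\<forall>n::int. x (j + n * int p) = x j" by simp
qed (auto simp: Per_def Per_letter_def)

lemma Per_D: "j \<in> Per p x \<Longrightarrow> x (j + n * int p) = x j"
  by (simp add: Per_iff)

lemma Per_shift_iff: "j + n * int p \<in> Per p x \<longleftrightarrow> j \<in> Per p x"
proof -
  have shift: "j + n * int p \<in> Per p x" if "j \<in> Per p x" for j n
  proof -
    have "x (j + n * int p + m * int p) = x (j + n * int p)" for m
      using Per_D[OF that, of "n + m"] Per_D[OF that, of n] by (simp add: algebra_simps)
    then show ?thesis by (simp add: Per_iff)
  qed
  show ?thesis
    using shift[of j n] shift[of "j + n * int p" "- n"] by auto
qed

lemma Per_mod_eq:
  assumes "i mod int p = j mod int p"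
  shows "i \<in> Per p x \<longleftrightarrow> j \<in> Per p x"
proof -
  have "int p dvd i - j" using assms by (simp add: mod_eq_dvd_iff)
  then obtain n where "i = j + n * int p" by (auto simp: dvd_def algebra_simps)
  then show ?thesis by (simp add: Per_shift_iff)
qed

lemma Per_value_mod_eq:
  assumes "j \<in> Per p x" "i mod int p = j mod int p"
  shows "x i = x j"
proof -
  have "int p dvd i - j" using assms(2) by (simp add: mod_eq_dvd_iff)
  then obtain n where "i = j + n * int p" by (auto simp: dvd_def algebra_simps)
  then show ?thesis using Per_D[OF assms(1)] by simp
qed

lemma Per_mono:
  assumes "p dvd q"
  shows "Per p x \<subseteq> Per q x"
proof
  fix j assume j: "j \<in> Per p x"
  obtain k where "q = p * k" using assms by blast
  then show "j \<in> Per q x"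
    using Per_D[OF j, of "_ * int k"] by (simp add: Per_iff algebra_simps)
qed

text \<open>By Bezout a multiple of the gcd is a \<open>q\<close>-part plus an
  \<open>r\<close>-part. The \<open>r\<close>-part is removed first: the point shifted by its
  \<open>q\<close>-part still lies in \<open>Per q x\<close>, hence in
  \<open>Per r x\<close>.\<close>

lemma Per_gcd:
  assumes "Per q x \<subseteq> Per r x"
  shows "Per q x \<subseteq> Per (gcd q r) x"
proof
  fix j assume j: "j \<in> Per q x"
  have "x (j + n * int (gcd q r)) = x j" for n
  proof -
    obtain u v where "u * int q + v * int r = gcd (int q) (int r)"
      using bezout_int by blast
    then have "int (gcd q r) = u * int q + v * int r" by simp
    then have "x (j + n * int (gcd q r)) = x ((j + (n * u) * int q) + (n * v) * int r)"
      by (simp add: algebra_simps)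
    also have "\<dots> = x (j + (n * u) * int q)"
      using assms j by (intro Per_D) (auto simp: Per_shift_iff)
    also have "\<dots> = x j" using j by (rule Per_D)
    finally show ?thesis .
  qed
  then show "j \<in> Per (gcd q r) x" by (simp add: Per_iff)
qed

text \<open>The periodic parts for \<open>q\<close> and \<open>gcd q r\<close> coincide, so
  minimality forbids \<open>gcd q r < q\<close>. This turns inclusions of periodic parts into
  divisibility of periods.\<close>

lemma minimal_period_dvd:
  assumes "q > 0" and min: "\<And>r. 0 < r \<Longrightarrow> r < q \<Longrightarrow> Per r x \<noteq> Per q x"
    and sub: "Per q x \<subseteq> Per r x"
  shows "q dvd r"
proof -
  have "Per (gcd q r) x = Per q x"
    using Per_gcd[OF sub] Per_mono[of "gcd q r" q x] by auto
  then have "\<not> gcd q r < q" using min[of "gcd q r"] \<open>q > 0\<close> by auto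
  then show ?thesis
    by (metis assms(1) gcd_dvd1 gcd_dvd2 dvd_imp_le le_antisym not_less)
qed

section \<open>Words with a period structure\<close>

lemma chain_dvd:
  fixes p :: "nat \<Rightarrow> nat"
  assumes "\<And>l. p l dvd p (Suc l)" "k \<le> l"
  shows "p k dvd p l"
  using assms(2) by (induction l rule: dec_induct) (auto intro: dvd_trans assms(1))

lemma finite_subset_Per_chain:
  assumes chain: "\<And>l. p l dvd p (Suc l)" and cover: "(\<Union>l. Per (p l) x) = UNIV"
    and "finite F"
  obtains M where "M \<ge> l" "F \<subseteq> Per (p M) x"
proof -
  have mono: "Per (p k) x \<subseteq> Per (p l) x" if "k \<le> l" for k l
    using chain_dvd[of p, OF chain that] by (rule Per_mono)
  from \<open>finite F\<close> have "\<exists>M\<ge>l. F \<subseteq> Per (p M) x"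
  proof (induction F)
    case (insert f F)
    then obtain M where M: "M \<ge> l" "F \<subseteq> Per (p M) x" by auto
    obtain k where "f \<in> Per (p k) x" using cover by blast
    then have "insert f F \<subseteq> Per (p (max M k)) x"
      using M mono[of M "max M k"] mono[of k "max M k"] by auto
    then show ?case using M by (intro exI[of _ "max M k"]) auto
  qed auto
  then show ?thesis using that by blast
qed

text \<open>A long block of \<open>x\<close> contains, at positions congruent to the original ones modulo \<open>p l\<close>,
  witnesses to the aperiodicity of every residue class outside \<open>Per (p l) x\<close>. So two occurrences of
  the block at distance \<open>d\<close> force \<open>Per (p l) x\<close> and its letters to be invariant under \<open>d\<close>, and
  the minimality of \<open>p l\<close> gives \<open>p l dvd d\<close>.\<close>

lemma block_determines_residue:
  assumes ps: "period_structure p x"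
  obtains N where "\<And>n m. (\<And>i. \<bar>i\<bar> \<le> N \<Longrightarrow> x (n + i) = x (m + i)) \<Longrightarrow>
    n mod int (p l) = m mod int (p l)"
proof -
  define P where "P = int (p l)"
  have pos: "\<And>l. p l > 0" and chain: "\<And>l. p l dvd p (Suc l)"
    and min: "\<And>l q. 0 < q \<Longrightarrow> q < p l \<Longrightarrow> Per q x \<noteq> Per (p l) x"
    and cover: "(\<Union>l. Per (p l) x) = UNIV"
    using ps unfolding period_structure_def by (blast, blast, metis, blast)
  have "P > 0" using pos by (simp add: P_def)
  have "\<exists>k. r \<notin> Per (p l) x \<longrightarrow> x (r + k * P) \<noteq> x r" for r
    by (auto simp: Per_iff P_def)
  then obtain k where k: "\<And>r. r \<notin> Per (p l) x \<Longrightarrow> x (r + k r * P) \<noteq> x r"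
    by metis
  \<comment> \<open>Every residue modulo \<open>P\<close> together with its witness of aperiodicity.
    \<open>F\<close> is finite, so one level \<open>M\<close> makes all its positions periodic, and
    \<open>M \<ge> l\<close> makes that period a multiple of \<open>P\<close>.\<close>
  define F where "F = {0..<P} \<union> (\<lambda>r. r + k r * P) ` {0..<P}"
  have "finite F" by (simp add: F_def)
  then obtain M where M: "M \<ge> l" "F \<subseteq> Per (p M) x"
    using finite_subset_Per_chain[of p x F, OF chain cover] by blast
  define Q where "Q = int (p M)"
  have "Q > 0" using pos by (simp add: Q_def)
  obtain B where B: "\<And>f. f \<in> F \<Longrightarrow> \<bar>f\<bar> \<le> B"
    using \<open>finite F\<close> by (meson Max_ge finite_imageI imageI)
  \<comment> \<open>\<open>F\<close> lies within distance \<open>B\<close> of 0, and the multiple of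
    \<open>Q\<close> just below \<open>n\<close> is less than \<open>Q\<close> away from
    \<open>n\<close>. So the window of radius \<open>N\<close> around any \<open>n\<close> contains
    a translate of \<open>F\<close> on which \<open>x\<close> repeats.\<close>
  define N where "N = B + Q"
  have copy: "\<exists>t. P dvd t \<and> (\<forall>f\<in>F. x (f + t) = x f \<and> \<bar>f + t - n\<bar> \<le> N)" for n
  proof (intro exI conjI ballI)
    show "P dvd (n div Q) * Q"
      using chain_dvd[of p, OF chain M(1)] by (simp add: P_def Q_def)
    fix f assume f: "f \<in> F"
    show "x (f + n div Q * Q) = x f"
      using M(2) f Per_D[of f "p M" x] by (auto simp: Q_def)
    have "n - n div Q * Q = n mod Q" by (simp add: minus_div_mult_eq_mod)
    moreover have "0 \<le> n mod Q" "n mod Q < Q" using \<open>Q > 0\<close> by auto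
    ultimately show "\<bar>f + n div Q * Q - n\<bar> \<le> N"
      using B[OF f] by (simp add: N_def)
  qed
  \<comment> \<open>The copies of \<open>r\<close> and \<open>r + k r * P\<close> near
    \<open>n\<close> are carried by \<open>m - n\<close> to positions congruent to
    \<open>s + (m - n)\<close>. Were that class constant, both would carry the same letter, against
    the choice of \<open>k r\<close>.\<close>
  have step: "s + (m - n) \<notin> Per (p l) x"
    if agree: "\<And>i. \<bar>i\<bar> \<le> N \<Longrightarrow> x (n + i) = x (m + i)" and s: "s \<notin> Per (p l) x" for n m s
  proof
    assume sd: "s + (m - n) \<in> Per (p l) x"
    obtain t where t: "P dvd t" "\<And>f. f \<in> F \<Longrightarrow> x (f + t) = x f"
      "\<And>f. f \<in> F \<Longrightarrow> \<bar>f + t - n\<bar> \<le> N"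
      using copy[of n] by metis
    have move: "x (f + t + (m - n)) = x f" if "f \<in> F" for f
      using agree[OF t(3)[OF that]] t(2)[OF that] by (simp add: algebra_simps)
    define r where "r = s mod P"
    have r: "r \<notin> Per (p l) x" using s Per_mod_eq[of r "p l" s x] by (simp add: r_def P_def)
    have F: "r \<in> F" "r + k r * P \<in> F" using \<open>P > 0\<close> by (auto simp: F_def r_def)
    have eq: "x (f + t + (m - n)) = x (s + (m - n))" if "f mod P = s mod P" for f
    proof (rule Per_value_mod_eq[OF sd])
      have "(f + (t + (m - n))) mod P = (s + (0 + (m - n))) mod P"
        using that t(1) by (intro mod_add_cong) auto
      then show "(f + t + (m - n)) mod int (p l) = (s + (m - n)) mod int (p l)"
        by (simp add: P_def algebra_simps)
    qed
    have "x (r + k r * P) = x r"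
      using eq[of r] eq[of "r + k r * P"] move F by (simp add: r_def)
    then show False using k[OF r] by simp
  qed
  have inv: "s + (m - n) \<in> Per (p l) x \<and> x (s + (m - n)) = x s"
    if agree: "\<And>i. \<bar>i\<bar> \<le> N \<Longrightarrow> x (n + i) = x (m + i)" and s: "s \<in> Per (p l) x" for n m s
  proof -
    \<comment> \<open>Contrapositive of \<open>step\<close> with the two blocks exchanged, so that
      the displacement is \<open>n - m\<close>.\<close>
    have sd: "s + (m - n) \<in> Per (p l) x"
      using step[of m n "s + (m - n)"] agree s by auto
    obtain t where t: "P dvd t" "\<And>f. f \<in> F \<Longrightarrow> x (f + t) = x f"
      "\<And>f. f \<in> F \<Longrightarrow> \<bar>f + t - n\<bar> \<le> N"
      using copy[of n] by metis
    define r where "r = s mod P"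
    have F: "r \<in> F" using \<open>P > 0\<close> by (auto simp: F_def r_def)
    have "x (s + (m - n)) = x (r + t + (m - n))"
    proof (rule sym, rule Per_value_mod_eq[OF sd])
      have "(r + (t + (m - n))) mod P = (s + (0 + (m - n))) mod P"
        using t(1) by (intro mod_add_cong) (auto simp: r_def)
      then show "(r + t + (m - n)) mod int (p l) = (s + (m - n)) mod int (p l)"
        by (simp add: P_def algebra_simps)
    qed
    also have "\<dots> = x (r + t)"
      using agree[OF t(3)[OF F]] by (simp add: algebra_simps)
    also have "\<dots> = x s"
      using t(2)[OF F] Per_value_mod_eq[OF s, of r] by (simp add: r_def P_def)
    finally show ?thesis using sd by blast
  qed
  have "n mod P = m mod P"
    if agree: "\<And>i. \<bar>i\<bar> \<le> N \<Longrightarrow> x (n + i) = x (m + i)" for n m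
  proof -
    have pos_mult: "s + int i * (m - n) \<in> Per (p l) x \<and> x (s + int i * (m - n)) = x s"
      if "s \<in> Per (p l) x" for s i
    proof (induction i)
      case (Suc i)
      then show ?case using inv[of n m "s + int i * (m - n)"] agree by (simp add: algebra_simps)
    qed (use that in auto)
    have neg_mult: "s + int i * (n - m) \<in> Per (p l) x \<and> x (s + int i * (n - m)) = x s"
      if "s \<in> Per (p l) x" for s i
    proof (induction i)
      case (Suc i)
      then show ?case using inv[of m n "s + int i * (n - m)"] agree by (simp add: algebra_simps)
    qed (use that in auto)
    \<comment> \<open>Agreement of blocks is symmetric, so invariance iterates in both directions.
      For \<open>m = n\<close> the right-hand side is \<open>Per 0 x\<close>, which is everything,
      and 0 is divisible by \<open>p l\<close>.\<close>
    have "Per (p l) x \<subseteq> Per (nat \<bar>m - n\<bar>) x"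
    proof
      fix s assume s: "s \<in> Per (p l) x"
      have "x (s + c * int (nat \<bar>m - n\<bar>)) = x s" for c
      proof -
        have "c * int (nat \<bar>m - n\<bar>) = int (nat \<bar>c\<bar>) * (m - n) \<or>
          c * int (nat \<bar>m - n\<bar>) = int (nat \<bar>c\<bar>) * (n - m)"
          by (auto simp: abs_if algebra_simps)
        then show ?thesis using pos_mult[OF s] neg_mult[OF s] by metis
      qed
      then show "s \<in> Per (nat \<bar>m - n\<bar>) x" by (simp add: Per_iff)
    qed
    then have "p l dvd nat \<bar>m - n\<bar>"
      using minimal_period_dvd[OF pos min] by blast
    then have "P dvd m - n"
      by (metis P_def dvd_abs_iff int_dvd_int_iff int_nat_eq abs_ge_zero)
    then show ?thesis by (metis mod_eq_dvd_iff)
  qed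
  then show ?thesis using that unfolding P_def by blast
qed

section \<open>Block codes\<close>

lemma openin_word_block:
  fixes z :: "int \<Rightarrow> 'a"
  assumes "finite W"
  shows "openin word_top {z'. \<forall>i\<in>W. z' i = z i}"
proof -
  define U where "U i = (if i \<in> W then {z i} else UNIV)" for i
  have "{i. U i \<noteq> topspace (discrete_topology UNIV)} \<subseteq> W"
    by (auto simp: U_def)
  then have "openin word_top (Pi\<^sub>E UNIV U)"
    using assms by (intro product_topology_basis) (auto intro: finite_subset)
  moreover have "Pi\<^sub>E UNIV U = {z'. \<forall>i\<in>W. z' i = z i}"
    by (fastforce simp: U_def PiE_iff split: if_splits)
  ultimately show ?thesis by simp
qed

lemma continuous_map_block_code:
  fixes F :: "(int \<Rightarrow> 'a) \<Rightarrow> int \<Rightarrow> 'b"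
  assumes "\<And>j z z'. (\<And>i. \<bar>i\<bar> \<le> N \<Longrightarrow> z (j + i) = z' (j + i)) \<Longrightarrow> F z j = F z' j"
  shows "continuous_map word_top word_top F"
proof -
  have "openin word_top {z. F z j \<in> U}" for j U
  proof (subst openin_subopen, intro ballI)
    fix z assume z: "z \<in> {z. F z j \<in> U}"
    define V where "V = {z'. \<forall>i\<in>{j-N..j+N}. z' i = z i}"
    have "F z' j = F z j" if "z' \<in> V" for z'
      using that by (intro assms) (auto simp: V_def abs_le_iff)
    then have "V \<subseteq> {z. F z j \<in> U}" using z by auto
    moreover have "openin word_top V" unfolding V_def by (rule openin_word_block) simp
    moreover have "z \<in> V" by (simp add: V_def)
    ultimately show "\<exists>T. openin word_top T \<and> z \<in> T \<and> T \<subseteq> {z. F z j \<in> U}" by blast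
  qed
  then show ?thesis
    unfolding continuous_map_componentwise_UNIV by (auto simp: continuous_map_def)
qed

text \<open>The image of the orbit closure is compact, hence closed, and contains the orbit of
  \<open>F x\<close>; this gives surjectivity. Continuity gives the other inclusion.\<close>

lemma factor_map_orbit_closure:
  fixes F :: "(int \<Rightarrow> 'a::finite) \<Rightarrow> int \<Rightarrow> 'a"
  assumes cont: "continuous_map word_top word_top F"
    and comm: "\<And>n z. F (shift_by n z) = shift_by n (F z)"
  shows "factor_map F (orbit_closure x) (orbit_closure (F x))"
proof -
  have image: "F ` range (\<lambda>n. shift_by n x) = range (\<lambda>n. shift_by n (F x))"
    by (auto simp: comm image_image)
  have compact: "compact_space (word_top :: (int \<Rightarrow> 'a) topology)"
    by (simp add: compact_space_product_topology compact_space_discrete_topology)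
  have Hausdorff: "Hausdorff_space (word_top :: (int \<Rightarrow> 'a) topology)"
    by (simp add: Hausdorff_space_product_topology)
  have "compactin word_top (orbit_closure x)"
    unfolding orbit_closure_def by (rule closedin_compact_space[OF compact]) simp
  then have "closedin word_top (F ` orbit_closure x)"
    using compactin_imp_closedin[OF Hausdorff] image_compactin[OF _ cont] by metis
  then have "orbit_closure (F x) \<subseteq> F ` orbit_closure x"
    unfolding orbit_closure_def image[symmetric]
    by (intro closure_of_minimal image_mono closure_of_subset) auto
  moreover have "F ` orbit_closure x \<subseteq> orbit_closure (F x)"
    unfolding orbit_closure_def image[symmetric]
    by (rule continuous_map_image_closure_subset[OF cont])
  ultimately have "F ` orbit_closure x = orbit_closure (F x)" by blast
  then show ?thesis
    unfolding factor_map_def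
    by (auto simp: comm continuous_map_in_subtopology intro!: continuous_map_from_subtopology[OF cont])
qed

section \<open>Odometers\<close>

lemma odometer_coherent:
  assumes chain: "\<And>l. p l dvd p (Suc l)" and w: "w \<in> odometer p" and "k \<le> l"
  shows "w l mod int (p k) = w k"
  using \<open>k \<le> l\<close>
proof (induction l rule: dec_induct)
  case base
  then show ?case using w by (auto simp: odometer_def)
next
  case (step l)
  have "w (Suc l) mod int (p k) = (w (Suc l) mod int (p l)) mod int (p k)"
    using chain_dvd[of p, OF chain step(1)] by (simp add: mod_mod_cancel)
  also have "\<dots> = w k" using w step by (auto simp: odometer_def)
  finally show ?case .
qed

lemma odometer_mod_coherent:
  assumes "\<And>l. p l dvd p (Suc l)" "w \<in> odometer p" "j mod int (p l) = w l" "k \<le> l"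
  shows "j mod int (p k) = w k"
proof -
  have "j mod int (p k) = w l mod int (p k)"
    using chain_dvd[of p, OF assms(1,4)] unfolding assms(3)[symmetric] by (simp add: mod_mod_cancel)
  then show ?thesis using odometer_coherent[of p, OF assms(1,2,4)] by simp
qed

lemma topspace_odometer_top [simp]: "topspace (odometer_top p) = odometer p"
  by (auto simp: odometer_top_def odometer_def)

lemma eta_in_odometer:
  assumes "\<And>l. p l > 0" "\<And>l. p l dvd p (Suc l)"
  shows "eta p j \<in> odometer p"
  using assms by (auto simp: odometer_def eta_def mod_mod_cancel)

lemma continuous_map_odometer_coordinate:
  "continuous_map (odometer_top p) (discrete_topology {0..<int (p l)}) (\<lambda>w. w l)"
  unfolding odometer_top_def
  by (intro continuous_map_from_subtopology continuous_map_product_projection) simp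

lemma openin_odometer_coordinate: "openin (odometer_top p) {w \<in> odometer p. w l \<in> U}"
proof -
  have "openin (odometer_top p) {w \<in> topspace (odometer_top p). w l \<in> U \<inter> {0..<int (p l)}}"
    by (rule openin_continuous_map_preimage[OF continuous_map_odometer_coordinate]) simp
  moreover have "{w \<in> topspace (odometer_top p). w l \<in> U \<inter> {0..<int (p l)}}
      = {w \<in> odometer p. w l \<in> U}"
    by (auto simp: odometer_def)
  ultimately show ?thesis by simp
qed

lemma closedin_odometer_coordinate: "closedin (odometer_top p) {w \<in> odometer p. w l \<in> U}"
proof -
  have "odometer p - {w \<in> odometer p. w l \<in> U} = {w \<in> odometer p. w l \<in> - U}" by auto
  then show ?thesis
    using openin_odometer_coordinate[of p l "- U"] by (auto simp: closedin_def)
qed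

text \<open>A basic open set restricts finitely many coordinates, and by coherence the coordinate at
  a level above them determines them all.\<close>

lemma odometer_neighbourhood_cylinder:
  assumes chain: "\<And>l. p l dvd p (Suc l)"
    and U: "openin (odometer_top p) U" "w \<in> U"
  obtains L where "\<And>w'. w' \<in> odometer p \<Longrightarrow> w' L = w L \<Longrightarrow> w' \<in> U"
proof -
  obtain V where V: "openin (product_topology (\<lambda>l. discrete_topology {0..<int (p l)}) UNIV) V"
    "U = V \<inter> odometer p"
    using U(1) by (auto simp: odometer_top_def openin_subtopology)
  have "w \<in> V" using U(2) V(2) by simp
  from product_topology_open_contains_basis[OF V(1) this]
  obtain X where X: "w \<in> Pi\<^sub>E UNIV X" "finite {i. X i \<noteq> {0..<int (p i)}}" "Pi\<^sub>E UNIV X \<subseteq> V"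
    unfolding topspace_discrete_topology by metis
  obtain L where L: "\<And>i. X i \<noteq> {0..<int (p i)} \<Longrightarrow> i \<le> L"
    using X(2) by (auto simp: finite_nat_set_iff_bounded_le)
  have w: "w \<in> odometer p" using U V by auto
  have "w' \<in> U" if w': "w' \<in> odometer p" "w' L = w L" for w'
  proof -
    have "w' i \<in> X i" for i
    proof (cases "X i = {0..<int (p i)}")
      case True
      then show ?thesis using w'(1) by (auto simp: odometer_def)
    next
      case False
      then have "w' i = w i"
        using odometer_coherent[of p, OF chain _ L[OF False]] w w' by metis
      then show ?thesis using X(1) by auto
    qed
    then have "w' \<in> Pi\<^sub>E UNIV X" by (simp add: PiE_iff)
    then show ?thesis using X(3) V(2) w'(1) by blast
  qed
  then show ?thesis using that by blast
qed

lemma odometer_letter_neighbourhood_cylinder: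
  assumes chain: "\<And>l. p l dvd p (Suc l)"
    and T: "openin (odometer_letter_top p) T" "(w, c) \<in> T"
  obtains L where "\<And>w'. w' \<in> odometer p \<Longrightarrow> w' L = w L \<Longrightarrow> (w', c) \<in> T"
proof -
  have "\<exists>U V. openin (odometer_top p) U \<and> openin (discrete_topology UNIV) V \<and> w \<in> U \<and> c \<in> V
      \<and> U \<times> V \<subseteq> T"
    by (rule openin_prod_topology_alt[THEN iffD1, rule_format, OF T])
  then obtain U where U: "openin (odometer_top p) U" "w \<in> U" "U \<times> {c} \<subseteq> T" by auto
  obtain L where "\<And>w'. w' \<in> odometer p \<Longrightarrow> w' L = w L \<Longrightarrow> w' \<in> U"
    using odometer_neighbourhood_cylinder[of p, OF chain U(1,2)] by metis
  then show ?thesis using U(3) that by blast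
qed

lemma compact_space_odometer_top: "compact_space (odometer_top p)"
proof -
  let ?T = "product_topology (\<lambda>l. discrete_topology {0..<int (p l)}) UNIV"
  have compact: "compact_space ?T"
    by (simp add: compact_space_product_topology compact_space_discrete_topology)
  have "closedin ?T {w \<in> topspace ?T. w (Suc l) mod int (p l) = w l}" for l
  proof -
    have proj: "continuous_map ?T (discrete_topology UNIV) (\<lambda>w. g (w k))" for k and g :: "int \<Rightarrow> int"
    proof -
      have "continuous_map ?T (discrete_topology UNIV) (g \<circ> (\<lambda>w. w k))"
        by (rule continuous_map_compose[OF continuous_map_product_projection]) auto
      then show ?thesis by (simp add: comp_def)
    qed
    show ?thesis
      by (rule closedin_continuous_maps_eq[OF _ proj proj[of "\<lambda>u. u"]]) simp
  qed
  then have "closedin ?T (\<Inter>l. {w \<in> topspace ?T. w (Suc l) mod int (p l) = w l})"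
    by (intro closedin_Inter) auto
  moreover have "(\<Inter>l. {w \<in> topspace ?T. w (Suc l) mod int (p l) = w l}) = odometer p"
    by (auto simp: odometer_def PiE_iff)
  ultimately show ?thesis
    unfolding odometer_top_def
    by (intro compact_space_subtopology closedin_compact_space[OF compact]) simp
qed

text \<open>Nested closed sets in a compact space. The hypotheses speak of integers only, because an
  integer in a class of \<open>C l\<close> gives, through \<open>eta\<close>, a point of the
  corresponding cylinder.\<close>

lemma compact_odometer_decreasing:
  assumes pos: "\<And>l. p l > 0" and chain: "\<And>l. p l dvd p (Suc l)"
    and inhabited: "\<And>l. \<exists>j. j mod int (p l) \<in> C l"
    and decreasing: "\<And>k l j. k \<le> l \<Longrightarrow> j mod int (p l) \<in> C l \<Longrightarrow> j mod int (p k) \<in> C k"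
  obtains w where "w \<in> odometer p" "\<And>l. w l \<in> C l"
proof -
  define D where "D l = {w \<in> odometer p. w l \<in> C l}" for l
  have mod: "w l mod int (p l) = w l" if "w \<in> odometer p" for w l
    using that by (auto simp: odometer_def)
  have "(\<Inter>l. D l) \<noteq> {}"
  proof (rule compact_space_imp_nest[OF compact_space_odometer_top])
    show "closedin (odometer_top p) (D l)" for l
      unfolding D_def by (rule closedin_odometer_coordinate)
    show "D l \<noteq> {}" for l
    proof -
      obtain j where "j mod int (p l) \<in> C l" using inhabited by blast
      then have "eta p j \<in> D l"
        using eta_in_odometer[of p, OF pos chain] by (simp add: D_def eta_def)
      then show ?thesis by blast
    qed
    show "decseq D"
      unfolding decseq_def
    proof (intro allI impI)
      fix k l :: nat assume "k \<le> l"
      show "D l \<subseteq> D k"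
      proof
        fix w assume "w \<in> D l"
        then have w: "w \<in> odometer p" "w l mod int (p l) \<in> C l" using mod by (auto simp: D_def)
        then have "w k \<in> C k"
          using decreasing[OF \<open>k \<le> l\<close> w(2)] odometer_coherent[of p, OF chain w(1) \<open>k \<le> l\<close>] by simp
        then show "w \<in> D k" using w(1) by (simp add: D_def)
      qed
    qed
  qed
  then obtain w where "\<And>l. w \<in> D l" by blast
  then show ?thesis using that by (auto simp: D_def)
qed

section \<open>Canonical maps between odometers\<close>

definition odometer_map :: "(nat \<Rightarrow> nat) \<Rightarrow> (nat \<Rightarrow> nat) \<Rightarrow> (nat \<Rightarrow> int) \<Rightarrow> nat \<Rightarrow> int" where
  "odometer_map m p w = (\<lambda>l. w (m l) mod int (p l))"

text \<open>Both sides are reductions of the coordinate at \<open>max i j\<close>. Hence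
  \<open>odometer_map m p w\<close> does not depend on which levels with
  \<open>p l dvd q (m l)\<close> are chosen.\<close>

lemma odometer_mod_eq:
  assumes chain: "\<And>l. q l dvd q (Suc l)" and w: "w \<in> odometer q"
    and "r dvd q i" "r dvd q j"
  shows "w i mod int r = w j mod int r"
proof -
  have "w k mod int r = w (max i j) mod int r" if "r dvd q k" "k \<le> max i j" for k
  proof -
    have "w (max i j) mod int (q k) mod int r = w (max i j) mod int r"
      using that(1) by (simp add: mod_mod_cancel)
    then show ?thesis using odometer_coherent[of q, OF chain w that(2)] by simp
  qed
  from this[of i] this[of j] show ?thesis using assms(3,4) by simp
qed

lemma odometer_map_in_odometer:
  assumes "\<And>l. p l > 0" "\<And>l. p l dvd p (Suc l)" "\<And>l. q l dvd q (Suc l)"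
    and m: "\<And>l. p l dvd q (m l)" and w: "w \<in> odometer q"
  shows "odometer_map m p w \<in> odometer p"
proof -
  have "w (m (Suc l)) mod int (p (Suc l)) mod int (p l) = w (m l) mod int (p l)" for l
  proof -
    have "w (m (Suc l)) mod int (p (Suc l)) mod int (p l) = w (m (Suc l)) mod int (p l)"
      using assms(2) by (simp add: mod_mod_cancel)
    also have "\<dots> = w (m l) mod int (p l)"
      using assms(2) m by (intro odometer_mod_eq[of q, OF assms(3) w]) (blast intro: dvd_trans)+
    finally show ?thesis .
  qed
  then show ?thesis
    using assms(1) by (simp add: odometer_def odometer_map_def)
qed

lemma odometer_map_inverse:
  assumes "\<And>l. q l dvd q (Suc l)" "\<And>l. p l dvd q (m l)" "\<And>l. q l dvd p (m' l)"
    and w: "w \<in> odometer q"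
  shows "odometer_map m' q (odometer_map m p w) = w"
proof
  fix l
  have "w (m (m' l)) mod int (p (m' l)) mod int (q l) = w (m (m' l)) mod int (q l)"
    using assms(3) by (simp add: mod_mod_cancel)
  also have "\<dots> = w l mod int (q l)"
    by (rule odometer_mod_eq[of q, OF assms(1) w dvd_trans[OF assms(3) assms(2)] dvd_refl])
  also have "\<dots> = w l" using w by (auto simp: odometer_def)
  finally show "odometer_map m' q (odometer_map m p w) l = w l"
    by (simp add: odometer_map_def)
qed

lemma continuous_map_odometer_map:
  assumes "\<And>l. p l > 0" "\<And>l. p l dvd p (Suc l)" "\<And>l. q l dvd q (Suc l)"
    and "\<And>l. p l dvd q (m l)"
  shows "continuous_map (odometer_top q) (odometer_top p) (odometer_map m p)"
proof -
  have "continuous_map (odometer_top q) (discrete_topology {0..<int (p l)})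
      (\<lambda>w. odometer_map m p w l)" for l
  proof -
    have "continuous_map (odometer_top q) (discrete_topology {0..<int (p l)})
        ((\<lambda>u. u mod int (p l)) \<circ> (\<lambda>w. w (m l)))"
      using assms(1) by (intro continuous_map_compose[OF continuous_map_odometer_coordinate]) auto
    then show ?thesis by (simp add: comp_def odometer_map_def)
  qed
  moreover have "odometer_map m p w \<in> odometer p" if "w \<in> odometer q" for w
    using odometer_map_in_odometer[of p q m w, OF assms that] .
  ultimately show ?thesis
    unfolding odometer_top_def[of p]
    by (simp add: continuous_map_in_subtopology continuous_map_componentwise_UNIV Pi_iff)
qed

text \<open>Divisibility in both directions yields canonical maps both ways; each is a reduction of
  coordinates, so they are mutually inverse and respect \<open>eta\<close>.\<close>

lemma has_odometer_cofinal:
  assumes ps: "period_structure q y"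
    and p: "\<And>l. p l > 0" "\<And>l. p l dvd p (Suc l)"
    and m: "\<And>l. \<exists>m. p l dvd q m" and m': "\<And>l. \<exists>m. q l dvd p m"
  shows "has_odometer y p"
proof -
  have q: "\<And>l. q l > 0" "\<And>l. q l dvd q (Suc l)"
    using ps unfolding period_structure_def by blast+
  obtain m where m: "\<And>l. p l dvd q (m l)" using m by metis
  obtain m' where m': "\<And>l. q l dvd p (m' l)" using m' by metis
  let ?h = "odometer_map m p"
  have "homeomorphic_maps (odometer_top q) (odometer_top p) ?h (odometer_map m' q)"
    unfolding homeomorphic_maps_def
    using continuous_map_odometer_map[of p q m, OF p q(2) m]
      continuous_map_odometer_map[of q p m', OF q p(2) m']
      odometer_map_inverse[of q p m m', OF q(2) m m']
      odometer_map_inverse[of p q m' m, OF p(2) m' m]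
    by simp
  then have "homeomorphic_map (odometer_top q) (odometer_top p) ?h"
    by (rule homeomorphic_maps_map[THEN iffD1, THEN conjunct1])
  moreover have "?h (rotation q w) = rotation p (?h w)" for w
    using m by (simp add: odometer_map_def rotation_def fun_eq_iff mod_mod_cancel mod_simps)
  moreover have "?h (eta q j) = eta p j" for j
    using m by (simp add: odometer_map_def eta_def fun_eq_iff mod_mod_cancel)
  ultimately show ?thesis
    using ps unfolding has_odometer_def by blast
qed

text \<open>Each \<open>p l\<close> is replaced by the least period with the same periodic part.
  Since these parts increase with \<open>l\<close>, minimality makes the least periods a
  divisibility chain.\<close>

lemma obtain_period_structure:
  assumes pos: "\<And>l. p l > 0" and chain: "\<And>l. p l dvd p (Suc l)"
    and nonempty: "Per (p 0) y \<noteq> {}" and cover: "(\<Union>l. Per (p l) y) = UNIV"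
  obtains q where "period_structure q y" "\<And>l. q l dvd p l" "\<And>l. Per (q l) y = Per (p l) y"
proof -
  define q where "q l = (LEAST r. 0 < r \<and> Per r y = Per (p l) y)" for l
  have q: "0 < q l" "Per (q l) y = Per (p l) y" for l
    using LeastI[of "\<lambda>r. 0 < r \<and> Per r y = Per (p l) y" "p l"] pos[of l]
    by (auto simp: q_def)
  have min: "Per r y \<noteq> Per (q l) y" if "0 < r" "r < q l" for r l
    using not_less_Least[of r "\<lambda>r. 0 < r \<and> Per r y = Per (p l) y"] that q(2)[of l]
    by (auto simp flip: q_def)
  have dvd: "q l dvd r" if "Per (q l) y \<subseteq> Per r y" for l r
    by (rule minimal_period_dvd[OF q(1) min that])
  have mono: "Per (p k) y \<subseteq> Per (p l) y" if "k \<le> l" for k l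
    using chain_dvd[of p, OF chain that] by (rule Per_mono)
  have "period_structure q y"
    unfolding period_structure_def
  proof (intro conjI allI impI)
    show "q l > 0" for l by (rule q)
    show "q l dvd q (Suc l)" for l using mono[of l "Suc l"] by (intro dvd) (simp add: q)
    show "Per (q l) y \<noteq> {}" for l using nonempty mono[of 0 l] by (auto simp: q)
    show "Per (q l) y \<noteq> Per r y" if "0 < r \<and> r < q l" for l r using min that by metis
    show "(\<Union>l. Per (q l) y) = UNIV" using cover by (simp add: q)
  qed
  then show ?thesis using that dvd q(2) by blast
qed

section \<open>Discontinuities of the semicocycle\<close>

text \<open>Cylinders are a neighbourhood base and letters are discrete, so the closure becomes a
  matter of congruences between integers.\<close>

lemma graph_closure_iff:
  assumes pos: "\<And>l. p l > 0" and chain: "\<And>l. p l dvd p (Suc l)"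
  shows "(w, c) \<in> graph_closure p x \<longleftrightarrow>
    w \<in> odometer p \<and> (\<forall>l. \<exists>j. j mod int (p l) = w l \<and> x j = c)"
proof (intro iffI conjI allI)
  assume wc: "(w, c) \<in> graph_closure p x"
  then show w: "w \<in> odometer p"
    by (auto simp: graph_closure_def in_closure_of)
  fix l
  let ?T = "{w' \<in> odometer p. w' l \<in> {w l}} \<times> {c}"
  have "openin (odometer_letter_top p) ?T"
    using openin_odometer_coordinate[of p l "{w l}"] by (simp add: openin_prod_Times_iff)
  moreover have "(w, c) \<in> ?T" using w by simp
  ultimately obtain z where "z \<in> semicocycle_graph p x" "z \<in> ?T"
    using wc[unfolded graph_closure_def in_closure_of, THEN conjunct2, rule_format, of ?T] by blast
  then show "\<exists>j. j mod int (p l) = w l \<and> x j = c"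
    by (auto simp: semicocycle_graph_def eta_def)
next
  assume R: "w \<in> odometer p \<and> (\<forall>l. \<exists>j. j mod int (p l) = w l \<and> x j = c)"
  show "(w, c) \<in> graph_closure p x"
    unfolding graph_closure_def in_closure_of
  proof (intro conjI allI impI)
    show "(w, c) \<in> topspace (odometer_letter_top p)" using R by simp
    fix T assume "(w, c) \<in> T \<and> openin (odometer_letter_top p) T"
    then obtain L where L: "\<And>w'. w' \<in> odometer p \<Longrightarrow> w' L = w L \<Longrightarrow> (w', c) \<in> T"
      using odometer_letter_neighbourhood_cylinder[of p T w c, OF chain] by metis
    obtain j where j: "j mod int (p L) = w L" "x j = c" using R by blast
    then have "(eta p j, x j) \<in> T"
      using eta_in_odometer[of p, OF pos chain] L[of "eta p j"] by (simp add: eta_def)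
    then show "\<exists>z. z \<in> semicocycle_graph p x \<and> z \<in> T"
      by (auto simp: semicocycle_graph_def)
  qed
qed

text \<open>If every letter of \<open>C\<close> were excluded at some level, finiteness of the
  alphabet would give a common bound \<open>M\<close> on these levels. A position matching
  \<open>w\<close> at level \<open>M\<close> matches it below, so its letter is excluded
  too.\<close>

lemma graph_closure_pigeonhole:
  fixes x :: "int \<Rightarrow> 'a::finite"
  assumes pos: "\<And>l. p l > 0" and chain: "\<And>l. p l dvd p (Suc l)" and w: "w \<in> odometer p"
    and C: "\<And>l. \<exists>j. j mod int (p l) = w l \<and> x j \<in> C"
  obtains c where "c \<in> C" "(w, c) \<in> graph_closure p x"
proof (rule ccontr)
  assume "\<not> thesis"
  then have "\<forall>c\<in>C. \<exists>l. \<forall>j. j mod int (p l) = w l \<longrightarrow> x j \<noteq> c"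
    using that graph_closure_iff[of p w _ x, OF pos chain] w by blast
  then obtain f where f: "\<And>c j. c \<in> C \<Longrightarrow> j mod int (p (f c)) = w (f c) \<Longrightarrow> x j \<noteq> c"
    by metis
  define M where "M = Max (range f)"
  have M: "f c \<le> M" for c by (simp add: M_def)
  obtain j where j: "j mod int (p M) = w M" "x j \<in> C" using C by blast
  have "j mod int (p k) = w k" if "k \<le> M" for k
    by (rule odometer_mod_coherent[of p, OF chain w j(1) that])
  then show False using f[OF j(2)] M by blast
qed

lemma is_singleton_graph_fibre_iff:
  assumes c: "(w, c) \<in> graph_closure p x"
  shows "is_singleton (graph_fibre p x w) \<longleftrightarrow> (\<forall>d. (w, d) \<in> graph_closure p x \<longrightarrow> d = c)"
proof -
  have mem: "(w, d) \<in> graph_fibre p x w \<longleftrightarrow> (w, d) \<in> graph_closure p x" for d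
    by (simp add: graph_fibre_def)
  show ?thesis
  proof
    assume "is_singleton (graph_fibre p x w)"
    then obtain z where z: "graph_fibre p x w = {z}" by (rule is_singletonE)
    then have "d = c" if "(w, d) \<in> graph_closure p x" for d
      using that mem[of c] mem[of d] c z by auto
    then show "\<forall>d. (w, d) \<in> graph_closure p x \<longrightarrow> d = c" by blast
  next
    assume "\<forall>d. (w, d) \<in> graph_closure p x \<longrightarrow> d = c"
    then have "graph_fibre p x w = {(w, c)}"
      using c unfolding graph_fibre_def by blast
    then show "is_singleton (graph_fibre p x w)" by simp
  qed
qed

text \<open>The fibre always contains some letter \<open>c\<close>. A class that is not constant
  carries a letter other than \<open>c\<close>; if this happens at every level, the pigeonhole
  argument on the complement of \<open>c\<close> gives a second point of the fibre.\<close>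

lemma discontinuities_iff:
  fixes x :: "int \<Rightarrow> 'a::finite"
  assumes pos: "\<And>l. p l > 0" and chain: "\<And>l. p l dvd p (Suc l)"
  shows "w \<in> discontinuities p x \<longleftrightarrow> w \<in> odometer p \<and> (\<forall>l. w l \<notin> Per (p l) x)"
proof (cases "w \<in> odometer p")
  case True
  note closure = graph_closure_iff[of p w _ x, OF pos chain]
  have mod: "w l mod int (p l) = w l" for l using True by (auto simp: odometer_def)
  obtain c where c: "(w, c) \<in> graph_closure p x"
    using graph_closure_pigeonhole[of p w x UNIV, OF pos chain True] mod by blast
  have "(\<exists>d. d \<noteq> c \<and> (w, d) \<in> graph_closure p x) \<longleftrightarrow> (\<forall>l. w l \<notin> Per (p l) x)"
  proof
    assume "\<exists>d. d \<noteq> c \<and> (w, d) \<in> graph_closure p x"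
    then obtain d where d: "d \<noteq> c" "(w, d) \<in> graph_closure p x" by blast
    show "\<forall>l. w l \<notin> Per (p l) x"
    proof (intro allI notI)
      fix l assume "w l \<in> Per (p l) x"
      moreover obtain i j where "i mod int (p l) = w l" "x i = c" "j mod int (p l) = w l" "x j = d"
        using c d(2) closure by blast
      ultimately show False using d(1) Per_value_mod_eq[of "w l" "p l" x] mod by metis
    qed
  next
    assume R: "\<forall>l. w l \<notin> Per (p l) x"
    have "\<exists>j. j mod int (p l) = w l \<and> x j \<in> - {c}" for l
    proof -
      obtain n where n: "x (w l + n * int (p l)) \<noteq> x (w l)"
        using R by (auto simp: Per_iff)
      have "(w l + n * int (p l)) mod int (p l) = w l" using mod by simp
      then show ?thesis using n mod[of l] by (metis ComplI singletonD)
    qed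
    then show "\<exists>d. d \<noteq> c \<and> (w, d) \<in> graph_closure p x"
      using graph_closure_pigeonhole[of p w x "- {c}", OF pos chain True] by blast
  qed
  then show ?thesis
    using True by (auto simp: discontinuities_def is_singleton_graph_fibre_iff[OF c])
qed (simp add: discontinuities_def)

text \<open>The discontinuities in the odometer of \<open>p\<close> are invariant under the kernel of the projection
  onto the odometer of \<open>y\<close>; as there is only one, this kernel is trivial.\<close>

lemma single_discontinuity_period_dvd:
  fixes y :: "int \<Rightarrow> 'a::finite"
  assumes pos: "\<And>l. p l > 0" and chain: "\<And>l. p l dvd p (Suc l)"
    and disc: "discontinuities p y = {w}"
    and q: "\<And>k. \<exists>l\<ge>k. \<exists>m. Per (q m) y = Per (p l) y"
  shows "\<exists>m. p l dvd q m"
proof -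
  note iff = discontinuities_iff[of p _ y, OF pos chain]
  have w: "w \<in> odometer p" "\<And>l. w l \<notin> Per (p l) y" using iff[of w] disc by auto
  have mono: "Per (p i) y \<subseteq> Per (p k) y" if "i \<le> k" for i k
    using chain_dvd[of p, OF chain that] by (rule Per_mono)
  \<comment> \<open>A point with all coordinates in these sets would be a discontinuity other than
    \<open>w\<close>. The guard \<open>l \<le> k\<close> is there because only then does a residue
    modulo \<open>p k\<close> determine one modulo \<open>p l\<close>.\<close>
  define C where "C k = {i. i \<notin> Per (p k) y \<and> (l \<le> k \<longrightarrow> i mod int (p l) \<noteq> w l)}" for k
  have "\<exists>k\<ge>l. \<forall>j. j \<notin> Per (p k) y \<longrightarrow> j mod int (p l) = w l"
  proof (rule ccontr)
    assume neg: "\<not> ?thesis"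
    obtain v where v: "v \<in> odometer p" "\<And>k. v k \<in> C k"
    proof (rule compact_odometer_decreasing[of p C, OF pos chain])
      have C_mod: "j mod int (p k) \<in> C k \<longleftrightarrow>
          j \<notin> Per (p k) y \<and> (l \<le> k \<longrightarrow> j mod int (p l) \<noteq> w l)" for j k
        using Per_mod_eq[of "j mod int (p k)" "p k" j y] chain_dvd[of p l k, OF chain]
        by (auto simp: C_def mod_mod_cancel)
      show "j mod int (p i) \<in> C i" if "i \<le> k" "j mod int (p k) \<in> C k" for i k j
        using that mono[of i k] by (auto simp: C_mod)
      show "\<exists>j. j mod int (p k) \<in> C k" for k
      proof -
        obtain j where "j \<notin> Per (p (max k l)) y" "j mod int (p l) \<noteq> w l"
          using neg max.cobounded2 by blast
        then show ?thesis using mono[of k "max k l"] by (auto simp: C_mod)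
      qed
    qed blast
    have "v = w" using v disc iff[of v] by (auto simp: C_def)
    moreover have "w l mod int (p l) = w l" using w(1) by (auto simp: odometer_def)
    ultimately show False using v(2)[of l] by (auto simp: C_def)
  qed
  then obtain k where k: "k \<ge> l" "\<And>j. j \<notin> Per (p k) y \<Longrightarrow> j mod int (p l) = w l" by blast
  obtain i m where i: "i \<ge> k" "Per (q m) y = Per (p i) y" using q by blast
  \<comment> \<open>Two positions at distance \<open>q m\<close> lie outside the same periodic part,
    hence outside \<open>Per (p k) y\<close>, where only one class modulo \<open>p l\<close> is
    left.\<close>
  have 1: "w i \<notin> Per (q m) y" using w(2)[of i] i(2) by simp
  then have "w i + 1 * int (q m) \<notin> Per (q m) y" unfolding Per_shift_iff .
  with 1 have "w i + int (q m) \<notin> Per (p k) y" "w i \<notin> Per (p k) y"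
    using mono[OF i(1)] i(2) by auto
  then have "(w i + int (q m)) mod int (p l) = w i mod int (p l)" using k(2) by simp
  then have "int (p l) dvd int (q m)" by (simp add: mod_eq_dvd_iff)
  then show ?thesis by auto
qed

section \<open>The factor with a single discontinuity\<close>

lemma isolated_letter_cylinder:
  assumes chain: "\<And>l. p l dvd p (Suc l)"
    and disc: "\<omega> \<in> discontinuities p x"
    and iso: "isolated_point_of (odometer_letter_top p) (\<omega>, a)
           (\<Union>\<omega>'\<in>discontinuities p x. graph_fibre p x \<omega>')"
  obtains L where "\<And>w. w \<in> discontinuities p x \<Longrightarrow> w L = \<omega> L \<Longrightarrow> (w, a) \<in> graph_closure p x
    \<Longrightarrow> w = \<omega>"
proof -
  let ?S = "\<Union>\<omega>'\<in>discontinuities p x. graph_fibre p x \<omega>'"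
  have "(\<omega>, a) \<in> topspace (odometer_letter_top p)"
    using disc by (simp add: discontinuities_def)
  then obtain T where T: "(\<omega>, a) \<in> T" "openin (odometer_letter_top p) T"
    "\<And>z. z \<in> ?S \<Longrightarrow> z \<in> T \<Longrightarrow> z = (\<omega>, a)"
    using iso unfolding isolated_point_of_def in_derived_set_of by metis
  obtain L where L: "\<And>w. w \<in> odometer p \<Longrightarrow> w L = \<omega> L \<Longrightarrow> (w, a) \<in> T"
    using odometer_letter_neighbourhood_cylinder[of p T \<omega> a, OF chain T(2,1)] by metis
  have "w = \<omega>" if "w \<in> discontinuities p x" "w L = \<omega> L" "(w, a) \<in> graph_closure p x" for w
  proof -
    have "(w, a) \<in> ?S" using that by (auto simp: graph_fibre_def)
    moreover have "(w, a) \<in> T"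
      using L[of w] that by (auto simp: discontinuities_def)
    ultimately show ?thesis using T(3) by blast
  qed
  then show ?thesis using that by blast
qed

theorem theorem5p2:
  fixes x :: "int \<Rightarrow> 'a::finite"
    and p :: "nat \<Rightarrow> nat"
    and \<omega> :: "nat \<Rightarrow> int"
    and a :: 'a
  assumes "toeplitz_word x"
    and "\<not> periodic_word x"
    and "period_structure p x"
    and "\<omega> \<in> discontinuities p x"
    and "(\<omega>, a) \<in> graph_closure p x"
    and "isolated_point_of (odometer_letter_top p) (\<omega>, a)
           (\<Union>\<omega>'\<in>discontinuities p x. graph_fibre p x \<omega>')"
  shows "\<exists>\<Psi> :: (int \<Rightarrow> 'a) \<Rightarrow> int \<Rightarrow> 'a.
           factor_map \<Psi> (orbit_closure x) (orbit_closure (\<Psi> x)) \<and>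
           toeplitz_word (\<Psi> x) \<and>
           has_odometer (\<Psi> x) p \<and>
           discontinuities p (\<Psi> x) = {\<omega>}"
proof -
  have pos: "\<And>l. p l > 0" and chain: "\<And>l. p l dvd p (Suc l)"
    and nonempty: "\<And>l. Per (p l) x \<noteq> {}" and cover: "(\<Union>l. Per (p l) x) = UNIV"
    using assms(3) unfolding period_structure_def by blast+
  note closure = graph_closure_iff[of p _ _ x, OF pos chain]
    and disc_iff = discontinuities_iff[of p, OF pos chain]
  have mono: "Per (p k) z \<subseteq> Per (p l) z" if "k \<le> l" for k l and z :: "int \<Rightarrow> 'a"
    using chain_dvd[of p, OF chain that] by (rule Per_mono)
  have coherent: "j mod int (p k) = w k"
    if "w \<in> odometer p" "j mod int (p l) = w l" "k \<le> l" for j k l w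
    by (rule odometer_mod_coherent[of p, OF chain that])
  have mod: "w l mod int (p l) = w l" if "w \<in> odometer p" for w l
    using that by (auto simp: odometer_def)
  have \<omega>: "\<omega> \<in> odometer p" using assms(4) by (simp add: discontinuities_def)
  \<comment> \<open>Taking \<open>b\<close> from the fibre over \<omega> provides positions
    arbitrarily close to \<omega> at which the new word has the letter \<open>b\<close>.\<close>
  obtain b where b: "b \<noteq> a" "(\<omega>, b) \<in> graph_closure p x"
    using assms(4) by (auto simp: discontinuities_def is_singleton_graph_fibre_iff[OF assms(5)])
  obtain L where L: "\<And>w. w \<in> discontinuities p x \<Longrightarrow> w L = \<omega> L \<Longrightarrow> (w, a) \<in> graph_closure p x
    \<Longrightarrow> w = \<omega>"
    using isolated_letter_cylinder[of p, OF chain assms(4,6)] by blast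
  obtain N where N: "\<And>n m. (\<And>i. \<bar>i\<bar> \<le> N \<Longrightarrow> x (n + i) = x (m + i)) \<Longrightarrow>
    n mod int (p L) = m mod int (p L)"
    using block_determines_residue[OF assms(3), of L] by blast
  \<comment> \<open>The window of \<open>z\<close> around \<open>j\<close> is searched for in
    \<open>x\<close> at positions of the class of \<open>\<omega> L\<close>. On \<open>x\<close>
    itself, the choice of \<open>N\<close> turns this into a condition on
    \<open>j mod p L\<close>.\<close>
  define \<Psi> :: "(int \<Rightarrow> 'a) \<Rightarrow> int \<Rightarrow> 'a" where "\<Psi> z j =
    (if (\<exists>n. n mod int (p L) = \<omega> L \<and> (\<forall>i. \<bar>i\<bar> \<le> N \<longrightarrow> x (n + i) = z (j + i))) \<and> z j = a
     then a else b)" for z j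
  define y where "y = \<Psi> x"
  have y: "y j = (if j mod int (p L) = \<omega> L \<and> x j = a then a else b)" for j
  proof -
    have "(\<exists>n. n mod int (p L) = \<omega> L \<and> (\<forall>i. \<bar>i\<bar> \<le> N \<longrightarrow> x (n + i) = x (j + i)))
        \<longleftrightarrow> j mod int (p L) = \<omega> L"
      using N by metis
    then show ?thesis by (simp add: y_def \<Psi>_def)
  qed

  have "factor_map \<Psi> (orbit_closure x) (orbit_closure (\<Psi> x))"
  proof (rule factor_map_orbit_closure)
    show "continuous_map word_top word_top \<Psi>"
    \<comment> \<open>A negative \<open>N\<close> would give an empty window, but the code also
      reads \<open>z j\<close>.\<close>
    proof (rule continuous_map_block_code[where N = "max N 0"])
      fix j :: int and z z' :: "int \<Rightarrow> 'a"
      assume agree: "\<And>i. \<bar>i\<bar> \<le> max N 0 \<Longrightarrow> z (j + i) = z' (j + i)"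
      from agree[of 0] agree show "\<Psi> z j = \<Psi> z' j" by (simp add: \<Psi>_def)
    qed
    show "\<Psi> (shift_by n z) = shift_by n (\<Psi> z)" for n z
      by (simp add: \<Psi>_def shift_by_def fun_eq_iff algebra_simps)
  qed

  \<comment> \<open>From level \<open>L\<close> on, steps of \<open>p l\<close> preserve membership
    in the cylinder.\<close>
  have Per_y: "Per (p l) x \<subseteq> Per (p l) y" if "L \<le> l" for l
  proof
    fix j assume j: "j \<in> Per (p l) x"
    have "int (p L) dvd int (p l)" using chain_dvd[of p, OF chain that] by simp
    then have "(j + n * int (p l)) mod int (p L) = j mod int (p L)" for n
      by (simp add: mod_eq_dvd_iff)
    then show "j \<in> Per (p l) y" using Per_D[OF j] by (simp add: Per_iff y)
  qed

  have disc_y: "discontinuities p y = {\<omega>}"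
  proof (intro equalityI subsetI)
    fix w assume "w \<in> discontinuities p y"
    then have w: "w \<in> odometer p" "\<And>l. w l \<notin> Per (p l) y" by (auto simp: disc_iff)
    \<comment> \<open>The new word takes two values on the class, so one of them is
      \<open>a\<close>; that value occurs only inside the cylinder and where \<open>x\<close> has
      \<open>a\<close>.\<close>
    have ex: "\<exists>j. j mod int (p l) = w l \<and> j mod int (p L) = \<omega> L \<and> x j = a" for l
    proof -
      obtain n where n: "y (w l + n * int (p l)) \<noteq> y (w l)"
        using w(2) by (auto simp: Per_iff)
      have "(w l + n * int (p l)) mod int (p l) = w l" using mod[OF w(1)] by simp
      then show ?thesis using n mod[OF w(1)] unfolding y by metis
    qed
    have "w L = \<omega> L" using ex[of L] by auto
    moreover have "(w, a) \<in> graph_closure p x" using ex w(1) closure by blast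
    moreover have "w l \<notin> Per (p l) x" for l
    proof
      assume "w l \<in> Per (p l) x"
      moreover have "w (max l L) mod int (p l) = w l mod int (p l)"
        using odometer_coherent[of p w l "max l L", OF chain w(1)] mod[OF w(1)] by simp
      ultimately have "w (max l L) \<in> Per (p l) x" using Per_mod_eq by blast
      then show False using mono[of l "max l L" x] Per_y[of "max l L"] w(2)[of "max l L"] by auto
    qed
    then have "w \<in> discontinuities p x" using w(1) by (simp add: disc_iff)
    ultimately show "w \<in> {\<omega>}" using L by blast
  next
    fix w assume "w \<in> {\<omega>}"
    moreover have "\<omega> l \<notin> Per (p l) y" for l
    proof
      assume Per: "\<omega> l \<in> Per (p l) y"
      \<comment> \<open>A position matching \<omega> at level \<open>max l L\<close> satisfies both
        congruences at once.\<close>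
      have ex: "\<exists>j. j mod int (p l) = \<omega> l \<and> j mod int (p L) = \<omega> L \<and> x j = c"
        if "(\<omega>, c) \<in> graph_closure p x" for c
        using that closure[of \<omega> c] coherent[OF \<omega>, of _ "max l L"]
        by (meson max.cobounded1 max.cobounded2)
      obtain i j where "i mod int (p l) = \<omega> l" "y i = a" "j mod int (p l) = \<omega> l" "y j = b"
        using ex[OF assms(5)] ex[OF b(2)] b(1) unfolding y by metis
      then show False using Per_value_mod_eq[OF Per] mod[OF \<omega>] b(1) by metis
    qed
    ultimately show "w \<in> discontinuities p y" using \<omega> by (simp add: disc_iff)
  qed

  have cover_y: "(\<Union>l. Per (p (L + l)) y) = UNIV"
  proof -
    have "j \<in> (\<Union>l. Per (p (L + l)) y)" for j
    proof -
      obtain l where "j \<in> Per (p l) x" using cover by blast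
      then have "j \<in> Per (p (L + l)) y"
        using mono[of l "L + l" x] Per_y[of "L + l"] by auto
      then show ?thesis by blast
    qed
    then show ?thesis by blast
  qed

  have "toeplitz_word y"
    unfolding toeplitz_word_def
  proof
    fix j
    obtain l where "j \<in> Per (p (L + l)) y" using cover_y by blast
    then show "\<exists>r::nat. r > 0 \<and> (\<forall>n::nat. y j = y (j + int n * int r))"
      using pos Per_D by metis
  qed

  moreover have "has_odometer y p"
  proof -
    \<comment> \<open>The chain starts at \<open>L\<close>, where a non-empty periodic part is
      inherited from \<open>x\<close>.\<close>
    have "Per (p (L + 0)) y \<noteq> {}" using nonempty[of L] Per_y[of L] by auto
    then obtain q where q: "period_structure q y" "\<And>l. q l dvd p (L + l)"
      "\<And>l. Per (q l) y = Per (p (L + l)) y"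
      using obtain_period_structure[of "\<lambda>l. p (L + l)" y] pos chain cover_y by auto
    show ?thesis
    proof (rule has_odometer_cofinal[of q y p, OF q(1) pos chain])
      show "\<exists>m. q l dvd p m" for l using q(2) by blast
      have "\<exists>l\<ge>k. \<exists>m. Per (q m) y = Per (p l) y" for k
        using q(3)[of k] le_add2 by blast
      then show "\<exists>m. p l dvd q m" for l
        by (rule single_discontinuity_period_dvd[of p y \<omega> q l, OF pos chain disc_y])
    qed
  qed

  ultimately show ?thesis
    using \<open>factor_map \<Psi> (orbit_closure x) (orbit_closure (\<Psi> x))\<close> disc_y
    unfolding y_def by blast
qed

end
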